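(* Let $(X,d)$ be a metric space, $Y$ a real Hausdorff topological vector space, $K\subset Y$ a proper convex cone, and $F:X\times X\rightrightarrows K$ a set-valued map such that $0\in F(x,x)$ for all $x\in X$ and $F(x_1,x_2)+F(x_2,x_3)\subseteq F(x_1,x_3)+K$ for all $x_1,x_2,x_3\in X$. Let $\mathcal{A}\subseteq X\times 2^Y$ be nonempty with $A\neq\emptyset$ for every $(x,A)\in\mathcal{A}$, and let $Y_{\mathcal{A}}:=\bigcup\{A\mid (x,A)\in\mathcal{A}\text{ for some }x\in X\}$. Assume that: (i) there exists $z_F^*\in K^+$ such that for every $\delta>0$, $$\inf\{z_F^*(v)\mid v\in F(x,x'),\ x,x'\in X,\ d(x,x')\ge\delta\}>0;$$ (ii) for every $\preceq_F$-decreasing sequence $((x_n,A_n))_{n\ge1}\subset\mathcal{A}$ with $(x_n)$ Cauchy there exists $(x,A)\in\mathcal{A}$ with $(x,A)\preceq_F(x_n,A_n)$ for all $n\ge1$; and $z_F^*(Y_{\mathcal{A}})$ is bounded from below, where $z_F^*$ is the functional from (i). Then for every $(x,A)\in\mathcal{A}$ there exists an element $(\overline{x},\overline{A})\in\mathcal{A}$, minimal in $\mathcal{A}$ with respect to $\preceq_{F,z_F^*}$, such that $(\overline{x},\overline{A})\preceq_{F,z_F^*}(x,A)$; moreover, for every $(x',A')\in\mathcal{A}$, $(x',A')\preceq_F(\overline{x},\overline{A})$ implies $x'=\overline{x}$.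
   Context: A proper convex cone $K$ satisfies $0\in K$, $K+K\subset K$, $tK\subset K$ for $t\ge0$, and $\{0\}\ne K\ne Y$. $K^+=\{y^*\in Y^*\mid y^*(y)\ge0\ \forall y\in K\}$, where $Y^*$ is the topological dual. Sums of sets are Minkowski sums with $\emptyset+A=A+\emptyset=\emptyset$; the values of $F$ are (possibly empty) subsets of $K$; $\inf\emptyset=+\infty$. The preorder $\preceq_F$ on $X\times2^Y$ is defined by $(x_1,A_1)\preceq_F(x_2,A_2)\iff A_2\subset A_1+F(x_1,x_2)+K$. For $z^*\in K^+$ the partial order $\preceq_{F,z^*}$ on $X\times 2^Y$ is defined by: $(x_1,A_1)\preceq_{F,z^*}(x_2,A_2)$ iff either $(x_1,A_1)=(x_2,A_2)$, or $(x_1,A_1)\preceq_F(x_2,A_2)$ and $\inf z^*(A_1)<\inf z^*(A_2)$. A sequence $(w_n)_{n\ge1}$ is decreasing for a relation $\preceq$ if $w_{n+1}\preceq w_n$ for all $n$; an element $w$ is minimal in $\mathcal{A}$ if $w'\in\mathcal{A}$, $w'\preceq w$ imply $w'=w$. *)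

theory Defs
  imports "HOL-Analysis.Analysis"
begin

text \<open>
  Real topological vector spaces, not necessarily locally convex. The Hausdorff axiom is not part
  of the class and is added through the sort \<^class>\<open>t2_space\<close>.
\<close>

class real_topological_vector_space = real_vector + topological_ab_group_add +
  assumes tendsto_scaleR_Pair:
    "LIM p (nhds c \<times>\<^sub>F nhds x). fst p *\<^sub>R snd p :> nhds (c *\<^sub>R x)"

instance real_normed_vector \<subseteq> real_topological_vector_space
proof
  fix c :: real and x :: 'a
  show "LIM p (nhds c \<times>\<^sub>F nhds x). fst p *\<^sub>R snd p :> nhds (c *\<^sub>R x)"
    by (intro tendsto_scaleR filterlim_fst filterlim_snd)
qed

text \<open>
  The sum of two sets is the Minkowski sum of \<^theory>\<open>HOL-Library.Set_Algebras\<close>; the sum with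
  the empty set is empty.
\<close>

definition proper_convex_cone :: "'y::real_vector set \<Rightarrow> bool" where
  "proper_convex_cone K \<longleftrightarrow>
     0 \<in> K \<and> K + K \<subseteq> K \<and> (\<forall>t\<ge>0. (\<lambda>y. t *\<^sub>R y) ` K \<subseteq> K) \<and> K \<noteq> {0} \<and> K \<noteq> UNIV"

definition topological_dual :: "('y::real_topological_vector_space \<Rightarrow> real) set" where
  "topological_dual = {f. linear f \<and> continuous_on UNIV f}"

definition dual_cone :: "'y::real_topological_vector_space set \<Rightarrow> ('y \<Rightarrow> real) set" where
  "dual_cone K = {f \<in> topological_dual. \<forall>y\<in>K. 0 \<le> f y}"

definition le_F ::
  "('x \<Rightarrow> 'x \<Rightarrow> 'y::real_vector set) \<Rightarrow> 'y set \<Rightarrow> 'x \<times> 'y set \<Rightarrow> 'x \<times> 'y set \<Rightarrow> bool" where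
  "le_F F K = (\<lambda>(x1, A1) (x2, A2). A2 \<subseteq> A1 + F x1 x2 + K)"

text \<open>Infima are taken in \<^typ>\<open>ereal\<close>, where the infimum of the empty set is \<open>\<infinity>\<close>.\<close>

definition le_Fz ::
  "('x \<Rightarrow> 'x \<Rightarrow> 'y::real_vector set) \<Rightarrow> 'y set \<Rightarrow> ('y \<Rightarrow> real) \<Rightarrow> 'x \<times> 'y set \<Rightarrow> 'x \<times> 'y set \<Rightarrow> bool"
where
  "le_Fz F K z = (\<lambda>(x1, A1) (x2, A2).
     (x1, A1) = (x2, A2) \<or>
     le_F F K (x1, A1) (x2, A2) \<and> (INF a\<in>A1. ereal (z a)) < (INF a\<in>A2. ereal (z a)))"

definition decreasing_seq :: "('w \<Rightarrow> 'w \<Rightarrow> bool) \<Rightarrow> (nat \<Rightarrow> 'w) \<Rightarrow> bool" where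
  "decreasing_seq R w \<longleftrightarrow> (\<forall>n. R (w (Suc n)) (w n))"

definition minimal_in :: "('w \<Rightarrow> 'w \<Rightarrow> bool) \<Rightarrow> 'w set \<Rightarrow> 'w \<Rightarrow> bool" where
  "minimal_in R S w \<longleftrightarrow> w \<in> S \<and> (\<forall>w'\<in>S. R w' w \<longrightarrow> w' = w)"

end

theory Submission
  imports Defs
begin

text \<open>
  Put \<open>\<phi>(x, A) = inf z(A)\<close>. Along \<open>\<preceq>\<^sub>F\<close> this function is monotone, and it drops by a fixed positive
  amount whenever the first component moves by at least \<open>\<delta>\<close>. Hence a decreasing sequence that at
  step \<open>n\<close> comes within \<open>1/(n+1)\<close> of the infimum of \<open>\<phi>\<close> over the elements below has a Cauchy
  first component. A lower bound of it minimizes \<open>\<phi>\<close> among the elements below itself, so no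
  element below it has a different first component.
\<close>

text \<open>The order-theoretic core, used below with \<open>S = \<A>\<close>,
  \<open>R = le_F F K\<close> and \<open>p = fst\<close>. Since \<open>R\<close> is only a preorder,
  the conclusion asks that \<open>\<phi>\<close> be constant below \<open>v\<close> instead of
  \<open>u = v\<close>.\<close>

lemma exists_minimizer_below:
  fixes R :: "'w \<Rightarrow> 'w \<Rightarrow> bool" and \<phi> :: "'w \<Rightarrow> real" and p :: "'w \<Rightarrow> 'x::metric_space"
  assumes refl: "\<And>u. u \<in> S \<Longrightarrow> R u u"
    and trans: "\<And>u v w. R u v \<Longrightarrow> R v w \<Longrightarrow> R u w"
    and bdd: "bdd_below (\<phi> ` S)"
    and mono: "\<And>u v. u \<in> S \<Longrightarrow> v \<in> S \<Longrightarrow> R u v \<Longrightarrow> \<phi> u \<le> \<phi> v"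
    and gap: "\<And>\<delta>. \<delta> > 0 \<Longrightarrow>
      \<exists>c>0. \<forall>u\<in>S. \<forall>v\<in>S. R u v \<longrightarrow> \<delta> \<le> dist (p u) (p v) \<longrightarrow> \<phi> u + c \<le> \<phi> v"
    and lower: "\<And>w. (\<And>n. w n \<in> S) \<Longrightarrow> decreasing_seq R w \<Longrightarrow> Cauchy (\<lambda>n. p (w n)) \<Longrightarrow>
      \<exists>v\<in>S. \<forall>n. R v (w n)"
    and "a \<in> S"
  shows "\<exists>v\<in>S. R v a \<and> (\<forall>u\<in>S. R u v \<longrightarrow> \<phi> u = \<phi> v)"
proof -
  have step: "\<exists>v. v \<in> S \<and> R v u \<and> (\<forall>t\<in>S. R t u \<longrightarrow> \<phi> v \<le> \<phi> t + 1 / Suc n)" if "u \<in> S" for u n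
  proof -
    let ?L = "{t \<in> S. R t u}"
    have ne: "\<phi> ` ?L \<noteq> {}" using that refl by auto
    have bd: "bdd_below (\<phi> ` ?L)" by (rule bdd_below_mono[OF bdd]) auto
    have "Inf (\<phi> ` ?L) < Inf (\<phi> ` ?L) + 1 / Suc n" by simp
    then obtain v where v: "v \<in> ?L" "\<phi> v < Inf (\<phi> ` ?L) + 1 / Suc n"
      using cInf_lessD[OF ne] by blast
    have "\<phi> v \<le> \<phi> t + 1 / Suc n" if "t \<in> S" "R t u" for t
    proof -
      have "Inf (\<phi> ` ?L) \<le> \<phi> t" using bd that by (intro cINF_lower) auto
      then show ?thesis using v(2) by linarith
    qed
    then show ?thesis using v(1) by blast
  qed
  \<comment> \<open>Dependent choice: each term nearly minimizes \<open>\<phi>\<close> below its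
    predecessor, with error tending to 0; the clause for \<open>n = 0\<close> fixes the start at
    \<open>a\<close>.\<close>
  have "\<exists>w. \<forall>n. (w n \<in> S \<and> (n = 0 \<longrightarrow> w n = a)) \<and>
      (R (w (Suc n)) (w n) \<and> (\<forall>t\<in>S. R t (w n) \<longrightarrow> \<phi> (w (Suc n)) \<le> \<phi> t + 1 / Suc n))"
    by (rule dependent_nat_choice) (use step \<open>a \<in> S\<close> in auto)
  then obtain w where w: "\<And>n. w n \<in> S" "w 0 = a" "\<And>n. R (w (Suc n)) (w n)"
    "\<And>n t. t \<in> S \<Longrightarrow> R t (w n) \<Longrightarrow> \<phi> (w (Suc n)) \<le> \<phi> t + 1 / Suc n"
    by blast
  have le: "R (w m) (w n)" if "n \<le> m" for m n
    using that by (induction rule: dec_induct) (blast intro: refl trans w)+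
  have "decseq (\<lambda>n. \<phi> (w n))"
    by (intro decseq_SucI mono w)
  moreover obtain B where "\<And>n. B \<le> \<phi> (w n)"
    using bdd w(1) by (auto simp: bdd_below_def)
  ultimately obtain l where "(\<lambda>n. \<phi> (w n)) \<longlonglongrightarrow> l"
    using decseq_convergent by metis
  then have cau: "Cauchy (\<lambda>n. \<phi> (w n))"
    by (rule LIMSEQ_imp_Cauchy)
  have "Cauchy (\<lambda>n. p (w n))"
  proof (rule CauchyI')
    fix \<delta> :: real assume "\<delta> > 0"
    then obtain c where c: "c > 0"
      "\<And>u v. u \<in> S \<Longrightarrow> v \<in> S \<Longrightarrow> R u v \<Longrightarrow> \<delta> \<le> dist (p u) (p v) \<Longrightarrow> \<phi> u + c \<le> \<phi> v"
      using gap by blast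
    obtain M where M: "\<And>m n. m \<ge> M \<Longrightarrow> n \<ge> M \<Longrightarrow> dist (\<phi> (w m)) (\<phi> (w n)) < c"
      using cau c(1) unfolding Cauchy_def by blast
    have "dist (p (w m)) (p (w n)) < \<delta>" if "m \<ge> M" "n > m" for m n
    \<comment> \<open>For \<open>m < n\<close> the term \<open>w n\<close> lies below
      \<open>w m\<close>, so a distance of at least \<delta> would force a drop of \<open>c\<close>
      in \<open>\<phi>\<close>, more than its oscillation beyond \<open>M\<close>.\<close>
    proof (rule ccontr)
      assume "\<not> ?thesis"
      then have "\<phi> (w n) + c \<le> \<phi> (w m)"
        using that by (intro c(2) w le) (auto simp: dist_commute)
      moreover have "dist (\<phi> (w m)) (\<phi> (w n)) < c" using that by (intro M) auto
      ultimately show False by (auto simp: dist_real_def)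
    qed
    then show "\<exists>M. \<forall>m\<ge>M. \<forall>n>m. dist (p (w m)) (p (w n)) < \<delta>" by blast
  qed
  then obtain v where v: "v \<in> S" "\<And>n. R v (w n)"
    using lower[of w] w by (auto simp: decreasing_seq_def)
  have "\<phi> u = \<phi> v" if u: "u \<in> S" "R u v" for u
  proof -
    \<comment> \<open>By transitivity \<open>u\<close> lies below every \<open>w n\<close>, so it
      was a competitor when \<open>w (Suc n)\<close> was chosen, while \<open>v\<close> lies below
      \<open>w (Suc n)\<close>.\<close>
    have "\<phi> v \<le> \<phi> u + 1 / Suc n" for n
      using mono[OF v(1) w(1) v(2), of "Suc n"] w(4)[OF u(1) trans[OF u(2) v(2)], of n] by linarith
    moreover have "(\<lambda>n. \<phi> u + 1 / Suc n) \<longlonglongrightarrow> \<phi> u + 0"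
      by (intro tendsto_add tendsto_const LIMSEQ_Suc lim_1_over_n)
    ultimately have "\<phi> v \<le> \<phi> u + 0"
      by (intro LIMSEQ_le_const) auto
    then show ?thesis using mono[OF u(1) v(1) u(2)] by simp
  qed
  moreover have "R v a" using v(2)[of 0] w(2) by simp
  ultimately show ?thesis using v(1) by blast
qed

lemma le_F_refl:
  assumes "proper_convex_cone K" and "\<And>x. 0 \<in> F x x"
  shows "le_F F K w w"
proof -
  obtain x A where eq: "w = (x, A)" by (metis surj_pair)
  have "a \<in> A + F x x + K" if "a \<in> A" for a
    using set_plus_intro[OF set_plus_intro[OF that assms(2)[of x]], of 0 K] assms(1)
    by (simp add: proper_convex_cone_def)
  then show ?thesis by (auto simp: le_F_def eq)
qed

text \<open>The hypothesis on \<open>F\<close> acts as a triangle inequality up to \<open>K\<close>;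
  the surplus copies of \<open>K\<close> are absorbed by \<open>K + K \<subseteq> K\<close>.\<close>

lemma le_F_trans:
  assumes K: "proper_convex_cone K"
    and F_trans: "\<And>x1 x2 x3. F x1 x2 + F x2 x3 \<subseteq> F x1 x3 + K"
    and "le_F F K u v" and "le_F F K v w"
  shows "le_F F K u w"
proof -
  obtain x1 A1 x2 A2 x3 A3 where eq: "u = (x1, A1)" "v = (x2, A2)" "w = (x3, A3)"
    by (metis surj_pair)
  have KK: "K + K \<subseteq> K" using K by (simp add: proper_convex_cone_def)
  have "A3 \<subseteq> A2 + F x2 x3 + K" "A2 \<subseteq> A1 + F x1 x2 + K"
    using assms(3,4) by (auto simp: le_F_def eq)
  then have "A3 \<subseteq> A1 + F x1 x2 + K + F x2 x3 + K"
    by (meson order_trans set_plus_mono2 order_refl)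
  also have "\<dots> = A1 + (F x1 x2 + F x2 x3) + (K + K)"
    by (simp add: ac_simps)
  also have "\<dots> \<subseteq> A1 + (F x1 x3 + K) + K"
    by (intro set_plus_mono2 F_trans KK order_refl)
  also have "\<dots> = A1 + F x1 x3 + (K + K)"
    by (simp add: ac_simps)
  also have "\<dots> \<subseteq> A1 + F x1 x3 + K"
    by (intro set_plus_mono2 KK order_refl)
  finally show ?thesis by (simp add: le_F_def eq)
qed

text \<open>Every point of \<open>A2\<close> splits as \<open>a + v + k\<close>, and
  \<open>z\<close> is additive with \<open>z v \<ge> c\<close> and \<open>z k \<ge> 0\<close>. The
  case \<open>c = 0\<close> gives monotonicity of the infimum, positive \<open>c\<close> its
  drop.\<close>

lemma le_F_Inf_gap:
  assumes z: "z \<in> dual_cone K" and le: "le_F F K (x1, A1) (x2, A2)"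
    and "A2 \<noteq> {}" and bdd: "bdd_below (z ` A1)"
    and c: "\<And>v. v \<in> F x1 x2 \<Longrightarrow> c \<le> z v"
  shows "Inf (z ` A1) + c \<le> Inf (z ` A2)"
proof (rule cINF_greatest[OF \<open>A2 \<noteq> {}\<close>])
  have lin: "linear z" and pos: "\<And>k. k \<in> K \<Longrightarrow> 0 \<le> z k"
    using z by (auto simp: dual_cone_def topological_dual_def)
  fix y assume "y \<in> A2"
  then have "y \<in> A1 + F x1 x2 + K" using le by (auto simp: le_F_def)
  then obtain a v k where y: "y = a + v + k" "a \<in> A1" "v \<in> F x1 x2" "k \<in> K"
    by (auto elim!: set_plus_elim)
  have "Inf (z ` A1) \<le> z a" using bdd y(2) by (rule cINF_lower)
  then show "Inf (z ` A1) + c \<le> z y"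
    using c[OF y(3)] pos[OF y(4)] by (simp add: y(1) linear_add[OF lin])
qed

theorem theorem5p4:
  fixes K :: "'y::{real_topological_vector_space, t2_space} set"
    and F :: "'x::metric_space \<Rightarrow> 'x \<Rightarrow> 'y set"
    and \<A> :: "('x \<times> 'y set) set"
    and z :: "'y \<Rightarrow> real"
  assumes K: "proper_convex_cone K"
    and F_K: "\<And>x x'. F x x' \<subseteq> K"
    and F_refl: "\<And>x. 0 \<in> F x x"
    and F_trans: "\<And>x1 x2 x3. F x1 x2 + F x2 x3 \<subseteq> F x1 x3 + K"
    and \<A>_nonempty: "\<A> \<noteq> {}"
    and \<A>_values: "\<And>x A. (x, A) \<in> \<A> \<Longrightarrow> A \<noteq> {}"
    and z_dual: "z \<in> dual_cone K"
    and z_pos: "\<And>\<delta>::real. \<delta> > 0 \<Longrightarrow> Inf {ereal (z v) | v x x'. v \<in> F x x' \<and> dist x x' \<ge> \<delta>} > 0"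
    and lower: "\<And>(x :: nat \<Rightarrow> 'x) (A :: nat \<Rightarrow> 'y set).
        (\<And>n. (x n, A n) \<in> \<A>) \<Longrightarrow> decreasing_seq (le_F F K) (\<lambda>n. (x n, A n)) \<Longrightarrow> Cauchy x \<Longrightarrow>
        \<exists>(x', A') \<in> \<A>. \<forall>n. le_F F K (x', A') (x n, A n)"
    and z_bdd: "bdd_below (z ` (\<Union>{A. \<exists>x. (x, A) \<in> \<A>}))"
  shows "\<forall>(x, A) \<in> \<A>. \<exists>(x\<^sub>0, A\<^sub>0) \<in> \<A>.
      minimal_in (le_Fz F K z) \<A> (x\<^sub>0, A\<^sub>0) \<and>
      le_Fz F K z (x\<^sub>0, A\<^sub>0) (x, A) \<and>
      (\<forall>(x', A') \<in> \<A>. le_F F K (x', A') (x\<^sub>0, A\<^sub>0) \<longrightarrow> x' = x\<^sub>0)"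
proof -
  let ?R = "le_F F K"
  \<comment> \<open>A real infimum replaces the extended one. The two agree on \<open>\<A>\<close>,
    where the sets are nonempty and \<open>z\<close> is bounded below on them.\<close>
  define \<phi> where "\<phi> w = Inf (z ` snd w)" for w :: "'x \<times> 'y set"
  have bdd: "bdd_below (z ` A)" if "(x, A) \<in> \<A>" for x A
    by (rule bdd_below_mono[OF z_bdd]) (use that in auto)
  have INF_\<phi>: "(INF a\<in>A. ereal (z a)) = ereal (\<phi> (x, A))" if "(x, A) \<in> \<A>" for x A
    using ereal_Inf'[OF bdd[OF that]] \<A>_values[OF that] by (simp add: \<phi>_def image_image)
  have mono: "\<phi> u \<le> \<phi> v" if "u \<in> \<A>" "v \<in> \<A>" "?R u v" for u v
  proof -
    obtain x1 A1 x2 A2 where eq: "u = (x1, A1)" "v = (x2, A2)" by (metis surj_pair)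
    have "0 \<le> z y" if "y \<in> F x1 x2" for y
      using z_dual F_K that by (auto simp: dual_cone_def)
    then show ?thesis
      using le_F_Inf_gap[OF z_dual, of F x1 A1 x2 A2 0] that bdd \<A>_values
      by (simp add: eq \<phi>_def)
  qed
  have gap: "\<exists>c>0. \<forall>u\<in>\<A>. \<forall>v\<in>\<A>. ?R u v \<longrightarrow> \<delta> \<le> dist (fst u) (fst v) \<longrightarrow> \<phi> u + c \<le> \<phi> v"
    if \<delta>: "\<delta> > 0" for \<delta>
  proof -
    \<comment> \<open>The infimum in (i) is \<open>\<infinity>\<close> if no values of
      \<open>F\<close> occur at distance at least \<delta>, so a real number strictly between 0 and
      it is taken.\<close>
    obtain c where c: "0 < ereal c"
      "ereal c < Inf {ereal (z v) | v x x'. v \<in> F x x' \<and> dist x x' \<ge> \<delta>}"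
      using ereal_dense2[OF z_pos[OF \<delta>]] by blast
    have "c \<le> z v" if "v \<in> F x x'" "\<delta> \<le> dist x x'" for v x x'
    proof -
      have "ereal c < ereal (z v)"
        by (rule less_le_trans[OF c(2)], rule Inf_lower) (use that in blast)
      then show ?thesis by simp
    qed
    then have "\<phi> u + c \<le> \<phi> v"
      if "u \<in> \<A>" "v \<in> \<A>" "?R u v" "\<delta> \<le> dist (fst u) (fst v)" for u v
      using le_F_Inf_gap[OF z_dual, of F "fst u" "snd u" "fst v" "snd v" c] that bdd \<A>_values
      by (cases u; cases v) (simp add: \<phi>_def)
    then show ?thesis using c(1) by auto
  qed
  have low: "\<exists>v\<in>\<A>. \<forall>n. ?R v (w n)"
    if "\<And>n. w n \<in> \<A>" "decreasing_seq ?R w" "Cauchy (\<lambda>n. fst (w n))" for w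
    using lower[of "\<lambda>n. fst (w n)" "\<lambda>n. snd (w n)"] that by auto
  have bdd_\<phi>: "bdd_below (\<phi> ` \<A>)"
  proof -
    obtain B where B: "\<And>x A a. (x, A) \<in> \<A> \<Longrightarrow> a \<in> A \<Longrightarrow> B \<le> z a"
      using z_bdd unfolding bdd_below_def by blast
    have "B \<le> \<phi> w" if "w \<in> \<A>" for w
    proof -
      obtain x A where w: "w = (x, A)" by (metis surj_pair)
      show ?thesis
        using that \<A>_values[of x A] B[of x A] by (auto simp: \<phi>_def w intro!: cINF_greatest)
    qed
    then show ?thesis by (rule bdd_belowI2)
  qed
  have refl: "?R u u" if "u \<in> \<A>" for u
    using K F_refl by (rule le_F_refl)
  have trans: "?R u w" if "?R u v" "?R v w" for u v w
    using K F_trans that by (rule le_F_trans)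
  \<comment> \<open>Distinct first components would allow \<open>gap\<close> with \<delta> equal to
    their distance, and hence a strict drop of \<open>\<phi>\<close>.\<close>
  have flat: "fst u = fst v" if uv: "u \<in> \<A>" "v \<in> \<A>" "?R u v" and "\<phi> u = \<phi> v" for u v
  proof (rule ccontr)
    assume "fst u \<noteq> fst v"
    then obtain c where "c > 0" "\<phi> u + c \<le> \<phi> v"
      using gap[of "dist (fst u) (fst v)"] uv by (metis order_refl zero_less_dist_iff)
    then show False using \<open>\<phi> u = \<phi> v\<close> by simp
  qed
  have less: "le_Fz F K z u v \<longleftrightarrow> u = v \<or> ?R u v \<and> \<phi> u < \<phi> v" if "u \<in> \<A>" "v \<in> \<A>" for u v
    using that by (cases u; cases v) (simp add: le_Fz_def INF_\<phi>)
  have "\<exists>v\<in>\<A>. minimal_in (le_Fz F K z) \<A> v \<and> le_Fz F K z v w \<and>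
      (\<forall>u\<in>\<A>. ?R u v \<longrightarrow> fst u = fst v)" if "w \<in> \<A>" for w
  proof -
    \<comment> \<open>If \<open>\<phi>\<close> is constant below \<open>v\<close>, the strict
      alternative in \<open>le_Fz\<close> cannot occur, and \<open>flat\<close> settles the first
      components.\<close>
    have good: "minimal_in (le_Fz F K z) \<A> v \<and> (\<forall>u\<in>\<A>. ?R u v \<longrightarrow> fst u = fst v)"
      if "v \<in> \<A>" "\<And>u. u \<in> \<A> \<Longrightarrow> ?R u v \<Longrightarrow> \<phi> u = \<phi> v" for v
      unfolding minimal_in_def using that less flat by (metis less_irrefl)
    show ?thesis
    \<comment> \<open>A minimizer below \<open>w\<close> might have the same value as
      \<open>w\<close> without being equal to it, and then it would not be
      \<open>le_Fz\<close>-below \<open>w\<close>. Starting the search from some \<open>t\<close> of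
      strictly smaller value avoids this.\<close>
    proof (cases "\<exists>t\<in>\<A>. ?R t w \<and> \<phi> t < \<phi> w")
      case True
      then obtain t where t: "t \<in> \<A>" "?R t w" "\<phi> t < \<phi> w" by blast
      have "\<exists>v\<in>\<A>. ?R v t \<and> (\<forall>u\<in>\<A>. ?R u v \<longrightarrow> \<phi> u = \<phi> v)"
        by (rule exists_minimizer_below[where p = fst]) (fact refl trans bdd_\<phi> mono gap low t)+
      then obtain v where v: "v \<in> \<A>" "?R v t" "\<And>u. u \<in> \<A> \<Longrightarrow> ?R u v \<Longrightarrow> \<phi> u = \<phi> v"
        by blast
      have "\<phi> v < \<phi> w" using mono[OF v(1) t(1) v(2)] t(3) by simp
      then show ?thesis
        using good[OF v(1,3)] v(1) trans[OF v(2) t(2)] less[OF v(1) that] by blast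
    next
      case False
      \<comment> \<open>Without such a \<open>t\<close>, monotonicity makes \<open>\<phi>\<close>
        constant below \<open>w\<close>, so \<open>w\<close> itself is the required element.\<close>
      have "\<phi> u = \<phi> w" if "u \<in> \<A>" "?R u w" for u
        using False mono[OF that(1) \<open>w \<in> \<A>\<close> that(2)] that by (meson antisym_conv2)
      then show ?thesis
        using good[OF that] that less[OF that that] by blast
    qed
  qed
  then show ?thesis by (simp add: case_prod_beta)
qed

end
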